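(* Let $G$ be a graph with minimum degree $\delta := \delta(G)\geq 2$. Then $$\gamma(X(G)) \leq 3\gamma(G) + \min_{S\in\mathcal{Q}}\{\gamma(G_S : V_{\delta-1}(G_S))\} - 1,$$ where $G_S = G-S$ and $\mathcal{Q}$ is the set of $\gamma(G)$-sets of $G$. Moreover, this bound is attainable, i.e. there exists a graph $G$ with $\delta(G)\ge 2$ for which equality holds.
   Context: All graphs are finite and undirected with no loops or multiple edges. An arc of a graph $G$ is an ordered pair of adjacent vertices; $uv$ denotes the arc from $u$ to $v$ (so $uv\neq vu$). A $3$-arc of $G$ is a 4-tuple $(v,u,x,y)$ of vertices, possibly with $v=y$, such that both $(v,u,x)$ and $(u,x,y)$ are paths of $G$. The $3$-arc graph $X(G)$ of $G$ is the graph whose vertices are the arcs of $G$, where two arcs $uv$ and $xy$ are adjacent if and only if $(v,u,x,y)$ is a $3$-arc of $G$ (equivalently, $u,x$ are adjacent in $G$, $v\neq x$ and $y\neq u$). For $S\subseteq V(G)$, $N[S]$ denotes the union of $S$ and the set of all vertices adjacent to some vertex of $S$, and $G-S$ is the subgraph of $G$ induced by $V(G)\setminus S$. A dominating set of $G$ is a set $S\subseteq V(G)$ with $N[S]=V(G)$; the domination number $\gamma(G)$ is the minimum cardinality of a dominating set, and a $\gamma(G)$-set is a dominating set of cardinality $\gamma(G)$. For a graph $H$ and an integer $i\ge 0$, $V_i(H) := \{x\in V(H) : \deg_H(x)\ge i\}$. For $U\subseteq V(H)$, an $(H:U)$-dominating set is a set $D\subseteq V(H)$ (not necessarily contained in $U$)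 with $U\subseteq N_H[D]$, and $\gamma(H:U)$ is the minimum cardinality of an $(H:U)$-dominating set. *)

theory Defs
  imports "Graph_Theory.Graph_Theory"
begin

text \<open>
  A graph is a \<open>pair_graph\<close>: a finite, loop-free digraph whose symmetric arc
  relation \<open>parcs G\<close> is a set of ordered pairs of vertices.  Hence \<open>parcs G\<close> is exactly the
  set of arcs of the graph, and the degree of a vertex equals its \<open>out_degree\<close>.
  The domination notions are stated for \<open>pre_digraph\<close> so that they also apply to
  \<open>G \<restriction> W\<close>; each \<open>pair_pre_digraph\<close> is coerced by \<open>with_proj\<close>.
  Note that \<open>u \<rightarrow>\<^bsub>G\<^esub> v\<close> is adjacency, although the library names it \<open>dominates\<close>.
\<close>

definition closed_nbhd :: "('a,'b) pre_digraph \<Rightarrow> 'a set \<Rightarrow> 'a set" where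
  "closed_nbhd G S = S \<union> {v. \<exists>u\<in>S. u \<rightarrow>\<^bsub>G\<^esub> v}"

definition dominating_set :: "('a,'b) pre_digraph \<Rightarrow> 'a set \<Rightarrow> bool" where
  "dominating_set G S \<longleftrightarrow> S \<subseteq> verts G \<and> closed_nbhd G S = verts G"

definition domination_number :: "('a,'b) pre_digraph \<Rightarrow> nat" where
  "domination_number G = Min (card ` {S. dominating_set G S})"

definition gamma_sets :: "('a,'b) pre_digraph \<Rightarrow> 'a set set" where
  "gamma_sets G = {S. dominating_set G S \<and> card S = domination_number G}"

definition rel_dominating_set :: "('a,'b) pre_digraph \<Rightarrow> 'a set \<Rightarrow> 'a set \<Rightarrow> bool" where
  "rel_dominating_set G U D \<longleftrightarrow> D \<subseteq> verts G \<and> U \<subseteq> closed_nbhd G D"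

definition rel_domination_number :: "('a,'b) pre_digraph \<Rightarrow> 'a set \<Rightarrow> nat" where
  "rel_domination_number G U = Min (card ` {D. rel_dominating_set G U D})"

definition min_degree :: "('a,'b) pre_digraph \<Rightarrow> nat" where
  "min_degree G = Min (out_degree G ` verts G)"

definition verts_of_degree_ge :: "nat \<Rightarrow> ('a,'b) pre_digraph \<Rightarrow> 'a set" where
  "verts_of_degree_ge i G = {x \<in> verts G. i \<le> out_degree G x}"

definition delete_verts :: "('a,'b) pre_digraph \<Rightarrow> 'a set \<Rightarrow> ('a,'b) pre_digraph" where
  "delete_verts G S = G \<restriction> (verts G - S)"

definition three_arc :: "'a pair_pre_digraph \<Rightarrow> 'a \<Rightarrow> 'a \<Rightarrow> 'a \<Rightarrow> 'a \<Rightarrow> bool" where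
  "three_arc G v u x y \<longleftrightarrow> vpath [v, u, x] G \<and> vpath [u, x, y] G"

text \<open>The arc \<open>uv\<close> (here \<open>(u, v)\<close>) is adjacent to \<open>xy\<close> iff \<open>(v, u, x, y)\<close>, which starts at
  the head of the first arc, is a 3-arc.\<close>

definition three_arc_graph :: "'a pair_pre_digraph \<Rightarrow> ('a \<times> 'a) pair_pre_digraph" where
  "three_arc_graph G = \<lparr> pverts = parcs G,
     parcs = {((u, v), (x, y)) | u v x y.
       (u, v) \<in> parcs G \<and> (x, y) \<in> parcs G \<and> three_arc G v u x y} \<rparr>"

context pair_graph
begin

lemma arc_sym: "(u, v) \<in> parcs G \<Longrightarrow> (v, u) \<in> parcs G"
  using pair_sym_arcs by (auto simp: symmetric_def elim: symE)

lemma three_arc_iff: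
  assumes "(u, v) \<in> parcs G" "(x, y) \<in> parcs G"
  shows "three_arc G v u x y \<longleftrightarrow> (u, x) \<in> parcs G \<and> v \<noteq> x \<and> y \<noteq> u"
  using assms arc_sym[OF assms(1)] wellformed' pair_no_loops
  by (fastforce simp: three_arc_def vpath_def vwalk_def)

lemma pair_graph_three_arc_graph: "pair_graph (three_arc_graph G)"
proof
  show "finite (parcs (three_arc_graph G))"
    by (rule finite_subset[of _ "parcs G \<times> parcs G"])
      (auto simp: three_arc_graph_def pair_finite_arcs)
  show "symmetric (with_proj (three_arc_graph G))"
    by (auto simp: three_arc_graph_def symmetric_def three_arc_iff intro!: symI dest: arc_sym)
next
  fix e assume "e \<in> parcs (three_arc_graph G)"
  then show "fst e \<noteq> snd e"
    using pair_no_loops by (fastforce simp: three_arc_graph_def three_arc_iff)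
qed (auto simp: three_arc_graph_def pair_finite_arcs)

end

end

theory Submission
  imports Defs
begin

text \<open>
  Let \<open>S\<close> be a minimum dominating set and let \<open>D\<close> dominate the vertices of large degree in
  \<open>G - S\<close>.  Each \<open>s \<in> S\<close> contributes three arcs \<open>sp\<close>, \<open>sq\<close>, \<open>pr\<close> with \<open>p \<noteq> q\<close> and \<open>r \<noteq> s\<close>: the
  first two dominate every arc \<open>uv\<close> such that \<open>u\<close> is adjacent to \<open>s\<close> and \<open>v \<noteq> s\<close>, while \<open>sp\<close> and \<open>pr\<close>
  dominate all arcs leaving \<open>s\<close>.  An arc \<open>uv\<close> that is missed leaves a vertex whose only
  neighbour in \<open>S\<close> is \<open>v\<close>, so \<open>u\<close> has large degree in \<open>G - S\<close>, and one arc from each \<open>d \<in> D\<close>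
  into \<open>S\<close> takes care of it.  One arc is saved by treating a single edge \<open>td\<close>, with \<open>t \<in> S\<close> and
  \<open>d \<notin> S\<close>, differently: the path \<open>td\<close>, \<open>dy\<close>, \<open>yz\<close> replaces the three arcs of \<open>t\<close> and the arc
  of \<open>d\<close>.  If \<open>D\<close> is empty, every vertex outside \<open>S\<close> has two neighbours in \<open>S\<close>, so \<open>y\<close> can be taken
  in \<open>S\<close> and \<open>yz\<close> is not needed.  The triangle attains the bound, since its 3-arc graph is
  a perfect matching on six vertices.
\<close>

section \<open>Domination and vertex deletion in terms of arcs\<close>

context pair_graph
begin

lemma arc_in_verts: "(u, v) \<in> parcs G \<Longrightarrow> u \<in> pverts G \<and> v \<in> pverts G"
  using wellformed' by fastforce

lemma adj_iff: "u \<rightarrow>\<^bsub>with_proj G\<^esub> v \<longleftrightarrow> (u, v) \<in> parcs G"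
  by (simp add: arcs_ends_def arc_to_ends_def)

lemma adj_delete_verts_iff:
  "u \<rightarrow>\<^bsub>delete_verts (with_proj G) S\<^esub> v \<longleftrightarrow> (u, v) \<in> parcs G \<and> u \<notin> S \<and> v \<notin> S"
  by (auto simp: delete_verts_def induce_subgraph_def arcs_ends_def arc_to_ends_def image_iff
      dest: arc_in_verts)

lemma verts_delete_verts [simp]: "verts (delete_verts (with_proj G) S) = pverts G - S"
  by (simp add: delete_verts_def)

lemma out_arcs_delete_verts:
  "out_arcs (delete_verts (with_proj G) S) u = {(u, v) | v. (u, v) \<in> parcs G \<and> u \<notin> S \<and> v \<notin> S}"
  by (auto simp: delete_verts_def induce_subgraph_def out_arcs_def dest: arc_in_verts)

lemma dominating_set_iff:
  "dominating_set (with_proj G) S \<longleftrightarrow>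
     S \<subseteq> pverts G \<and> (\<forall>v\<in>pverts G - S. \<exists>u\<in>S. (u, v) \<in> parcs G)"
  by (auto simp: dominating_set_def closed_nbhd_def adj_iff dest: arc_in_verts)

lemma finite_dominating_sets: "finite {S. dominating_set (with_proj G) S}"
  by (rule finite_subset[of _ "Pow (pverts G)"])
    (auto simp: dominating_set_def pair_finite_verts)

lemma domination_number_le:
  assumes "dominating_set (with_proj G) S"
  shows "domination_number (with_proj G) \<le> card S"
  unfolding domination_number_def
  using assms finite_dominating_sets by (intro Min_le) auto

lemma dominating_set_verts: "dominating_set (with_proj G) (pverts G)"
  by (simp add: dominating_set_iff)

lemma domination_number_attained:
  obtains S where "dominating_set (with_proj G) S" "card S = domination_number (with_proj G)"
proof -
  have "domination_number (with_proj G) \<in> card ` {S. dominating_set (with_proj G) S}"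
    unfolding domination_number_def
    using finite_dominating_sets dominating_set_verts by (intro Min_in) auto
  then show thesis using that by auto
qed

lemma finite_gamma_sets: "finite (gamma_sets (with_proj G))"
  using finite_dominating_sets by (simp add: gamma_sets_def)

lemma gamma_sets_nonempty: "gamma_sets (with_proj G) \<noteq> {}"
  using domination_number_attained by (auto simp: gamma_sets_def)

lemma finite_rel_dominating_sets:
  "finite {D. rel_dominating_set (delete_verts (with_proj G) S) U D}"
  by (rule finite_subset[of _ "Pow (pverts G)"])
    (auto simp: rel_dominating_set_def pair_finite_verts)

lemma rel_domination_number_attained:
  assumes "U \<subseteq> pverts G - S"
  obtains D where "rel_dominating_set (delete_verts (with_proj G) S) U D"
    "card D = rel_domination_number (delete_verts (with_proj G) S) U"
proof -
  have "rel_dominating_set (delete_verts (with_proj G) S) U (pverts G - S)"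
    using assms by (auto simp: rel_dominating_set_def closed_nbhd_def)
  then have "rel_domination_number (delete_verts (with_proj G) S) U
      \<in> card ` {D. rel_dominating_set (delete_verts (with_proj G) S) U D}"
    unfolding rel_domination_number_def
    using finite_rel_dominating_sets by (intro Min_in) auto
  then show thesis using that by auto
qed

section \<open>Consequences of the minimum degree\<close>

lemma min_degree_le_out_degree:
  "u \<in> pverts G \<Longrightarrow> min_degree (with_proj G) \<le> out_degree (with_proj G) u"
  unfolding min_degree_def by (intro Min_le) (auto simp: pair_finite_verts)

lemma exists_other_neighbour:
  assumes "min_degree (with_proj G) \<ge> 2" "u \<in> pverts G"
  shows "\<exists>v. (u, v) \<in> parcs G \<and> v \<noteq> w"
proof (rule ccontr)
  assume "\<not> ?thesis"
  then have "out_arcs (with_proj G) u \<subseteq> {(u, w)}"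
    by (auto simp: out_arcs_def)
  then have "out_degree (with_proj G) u \<le> 1"
    unfolding out_degree_def using card_mono[of "{(u, w)}"] by fastforce
  then show False
    using assms min_degree_le_out_degree[of u] by simp
qed

text \<open>Deleting \<open>S\<close> removes at most the arc \<open>(u, v)\<close> from those
  leaving \<open>u\<close>. This is what places vertices with a single neighbour in \<open>S\<close>
  among those that \<open>D\<close> has to dominate.\<close>

lemma out_degree_delete_verts:
  assumes "u \<in> pverts G" "u \<notin> S"
    and unique: "\<And>s. s \<in> S \<Longrightarrow> (u, s) \<in> parcs G \<Longrightarrow> s = v"
  shows "min_degree (with_proj G) - 1 \<le> out_degree (delete_verts (with_proj G) S) u"
proof -
  let ?O = "out_arcs (delete_verts (with_proj G) S) u"
  have "finite ?O"
    by (rule finite_subset[of _ "parcs G"]) (auto simp: out_arcs_delete_verts pair_finite_arcs)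
  moreover have "out_arcs (with_proj G) u \<subseteq> insert (u, v) ?O"
    using assms by (auto simp: out_arcs_delete_verts)
  ultimately have "card (out_arcs (with_proj G) u) \<le> card (insert (u, v) ?O)"
    by (intro card_mono) auto
  also have "\<dots> \<le> Suc (card ?O)"
    using \<open>finite ?O\<close> by (simp add: card_insert_if)
  finally have "card (out_arcs (with_proj G) u) \<le> Suc (card ?O)" .
  moreover have "min_degree (with_proj G) \<le> card (out_arcs (with_proj G) u)"
    using min_degree_le_out_degree[OF assms(1)] unfolding out_degree_def .
  ultimately show ?thesis
    unfolding out_degree_def by linarith
qed

section \<open>Domination in the 3-arc graph\<close>

lemma dominating_set_three_arc_graphI:
  assumes "A \<subseteq> parcs G"
    and "\<And>u v. (u, v) \<in> parcs G \<Longrightarrow> (u, v) \<notin> A \<Longrightarrow>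
      \<exists>(x, y)\<in>A. (u, x) \<in> parcs G \<and> v \<noteq> x \<and> y \<noteq> u"
  shows "dominating_set (with_proj (three_arc_graph G)) A"
proof -
  interpret X: pair_graph "three_arc_graph G" by (rule pair_graph_three_arc_graph)
  show ?thesis
    unfolding X.dominating_set_iff
  proof safe
    fix u v assume "(u, v) \<in> pverts (three_arc_graph G)" and notin: "(u, v) \<notin> A"
    then have uv: "(u, v) \<in> parcs G" by (simp add: three_arc_graph_def)
    with assms(2) notin obtain x y where
      "(x, y) \<in> A" "(u, x) \<in> parcs G" "v \<noteq> x" "y \<noteq> u" by blast
    moreover have "(x, y) \<in> parcs G" "(x, u) \<in> parcs G"
      using calculation assms(1) arc_sym by blast+
    ultimately show "\<exists>a\<in>A. (a, (u, v)) \<in> parcs (three_arc_graph G)"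
      using uv by (intro bexI[of _ "(x, y)"]) (auto simp: three_arc_graph_def three_arc_iff)
  qed (use assms(1) in \<open>auto simp: three_arc_graph_def\<close>)
qed

text \<open>The construction for a given path \<open>t\<close>, \<open>d\<close>, \<open>y\<close>.
  Since \<open>d\<close> may lie inside or outside \<open>D\<close>, one count serves both nonempty
  and empty \<open>D\<close>: the term \<open>card (D - {d})\<close> records the arc saved when
  \<open>d\<close> is in \<open>D\<close>, and the conditional term pays for the arc leaving
  \<open>y\<close>.\<close>

lemma three_arc_domination_number_le:
  assumes deg: "min_degree (with_proj G) \<ge> 2"
    and S: "dominating_set (with_proj G) S"
    and D: "D \<subseteq> pverts G - S"
    and cover: "\<And>u v. u \<in> pverts G - S \<Longrightarrow> (\<And>s. s \<in> S \<Longrightarrow> (u, s) \<in> parcs G \<Longrightarrow> s = v) \<Longrightarrow>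
      \<exists>d\<in>D. u = d \<or> (u, d) \<in> parcs G"
    and t: "t \<in> S" "d \<notin> S" "(t, d) \<in> parcs G"
    and y: "(d, y) \<in> parcs G" "y \<noteq> t"
  shows "domination_number (with_proj (three_arc_graph G)) + 1 \<le>
    3 * card S + card (D - {d}) + (if y \<in> S then 0 else 1)"
proof -
  interpret X: pair_graph "three_arc_graph G" by (rule pair_graph_three_arc_graph)
  have S_verts: "S \<subseteq> pverts G"
    using S by (simp add: dominating_set_iff)
  have fin: "finite S" "finite D"
    using S_verts D pair_finite_verts by (auto intro: finite_subset)
  have "\<exists>p q r. (s, p) \<in> parcs G \<and> (s, q) \<in> parcs G \<and> p \<noteq> q \<and> (p, r) \<in> parcs G \<and> r \<noteq> s"
    if "s \<in> S" for s
  proof -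
    have s: "s \<in> pverts G" using that S_verts by blast
    obtain p where p: "(s, p) \<in> parcs G"
      using exists_other_neighbour[OF deg s] by blast
    then show ?thesis
      using exists_other_neighbour[OF deg s, of p] exists_other_neighbour[OF deg, of p s]
        arc_in_verts[OF p] by metis
  qed
  then obtain p q r where pqr: "\<And>s. s \<in> S \<Longrightarrow>
      (s, p s) \<in> parcs G \<and> (s, q s) \<in> parcs G \<and> p s \<noteq> q s \<and> (p s, r s) \<in> parcs G \<and> r s \<noteq> s"
    by metis
  have "\<exists>s\<in>S. (u, s) \<in> parcs G" if "u \<in> pverts G - S" for u
    using S that arc_sym unfolding dominating_set_iff by blast
  then obtain f where f: "\<And>u. u \<in> pverts G - S \<Longrightarrow> f u \<in> S \<and> (u, f u) \<in> parcs G"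
    by metis
  define B where "B = (\<Union>s\<in>S - {t}. {(s, p s), (s, q s), (p s, r s)})"
  define C where "C = (\<lambda>u. (u, f u)) ` (D - {d})"
  \<comment> \<open>If \<open>y\<close> is in \<open>S\<close>, then \<open>y \<noteq> t\<close> and
    \<open>B\<close> already contains arcs leaving \<open>y\<close>.\<close>
  define F where "F = (if y \<in> S then {} else {(y, f y)})"
  define A where "A = {(t, d), (d, y)} \<union> F \<union> B \<union> C"
  have verts: "t \<in> pverts G" "d \<in> pverts G" "y \<in> pverts G"
    using t y arc_in_verts by blast+
  have sub: "A \<subseteq> parcs G"
    using t y pqr f D verts by (auto simp: A_def B_def C_def F_def)
  define hit where "hit u v \<longleftrightarrow> (\<exists>(x, y)\<in>A. (u, x) \<in> parcs G \<and> v \<noteq> x \<and> y \<noteq> u)" for u v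
  have hitI: "hit u v" if "(x, y) \<in> A" "(u, x) \<in> parcs G" "v \<noteq> x" "y \<noteq> u" for u v x y
    unfolding hit_def using that by (intro bexI[of _ "(x, y)"]) auto
  have td: "(t, d) \<in> A" and dy: "(d, y) \<in> A"
    by (simp_all add: A_def)
  \<comment> \<open>The heads \<open>p s\<close> and \<open>q s\<close> differ, so at least one of
    the two arcs leaving \<open>s\<close> does not end in \<open>u\<close>.\<close>
  have near_S: "hit u v" if s: "s \<in> S" "s \<noteq> t" "(u, s) \<in> parcs G" "s \<noteq> v" for s u v
  proof -
    have mem: "(s, p s) \<in> A" "(s, q s) \<in> A"
      using s by (auto simp: A_def B_def)
    show ?thesis
    proof (cases "p s = u")
      case True
      then have "q s \<noteq> u" using pqr[OF s(1)] by metis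
      then show ?thesis using mem(2) s by (intro hitI[of s "q s"]) auto
    next
      case False
      then show ?thesis using mem(1) s by (intro hitI[of s "p s"]) auto
    qed
  qed
  \<comment> \<open>Arcs leaving \<open>d\<close> need separate care: \<open>(t, d)\<close> has head
    \<open>d\<close> and so cannot dominate them.\<close>
  have from_d: "hit d v" if "v \<noteq> y" for v
  proof (cases "y \<in> S")
    case True
    then show ?thesis using near_S[of y d v] y that by simp
  next
    case False
    then have "(y, f y) \<in> A" "f y \<noteq> d"
      using f[of y] verts t by (auto simp: A_def F_def)
    then show ?thesis using y that by (intro hitI[of y "f y"]) auto
  qed
  have "dominating_set (with_proj (three_arc_graph G)) A"
  proof (rule dominating_set_three_arc_graphI[OF sub])
    fix u v assume uv: "(u, v) \<in> parcs G" "(u, v) \<notin> A"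
    have uv_verts: "u \<in> pverts G" "v \<in> pverts G"
      using arc_in_verts[OF uv(1)] by simp_all
    consider "u = t" | "u = d" | "u \<in> S" "u \<noteq> t" | "u \<notin> S" "u \<noteq> d"
      by blast
    then have "hit u v"
    proof cases
      case 1
      then have "v \<noteq> d" using td uv(2) by blast
      then show ?thesis using dy t y 1 by (intro hitI[of d y]) auto
    next
      case 2
      then have "v \<noteq> y" using dy uv(2) by blast
      then show ?thesis using from_d 2 by simp
    next
      case 3
      then have mem: "(u, p u) \<in> A" "(p u, r u) \<in> A"
        by (auto simp: A_def B_def)
      then have "v \<noteq> p u" using uv(2) by blast
      then show ?thesis using pqr[OF 3(1)] mem(2) by (intro hitI[of "p u" "r u"]) auto
    next
      case 4
      \<comment> \<open>Any neighbour of \<open>u\<close> in \<open>S\<close> other than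
        \<open>v\<close> supplies a dominating arc; otherwise \<open>v\<close> is the only neighbour
        of \<open>u\<close> in \<open>S\<close>, and \<open>D\<close> is called upon.\<close>
      show ?thesis
      proof (cases "\<exists>s\<in>S. (u, s) \<in> parcs G \<and> s \<noteq> v")
        case True
        then obtain s where s: "s \<in> S" "(u, s) \<in> parcs G" "s \<noteq> v" by blast
        show ?thesis
        proof (cases "s = t")
          case True
          then show ?thesis using s td 4 by (intro hitI[of t d]) auto
        next
          case False
          then show ?thesis using near_S s by simp
        qed
      next
        case False
        have fu: "f u \<in> S" "(u, f u) \<in> parcs G"
          using f[of u] uv_verts(1) 4(1) by simp_all
        then have fuv: "f u = v" using False by metis
        then have v: "v \<in> S" using fu by simp
        obtain e where e: "e \<in> D" "u = e \<or> (u, e) \<in> parcs G"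
          using cover[of u v] False uv_verts(1) 4(1) by blast
        have "e \<notin> S" using e(1) D by blast
        show ?thesis
        proof (cases "e = d")
          case True
          then have "(u, d) \<in> parcs G" using e(2) 4(2) by simp
          \<comment> \<open>If \<open>y = u\<close>, then \<open>y\<close> is outside
            \<open>S\<close> and \<open>(u, v)\<close> is the arc \<open>(y, f y)\<close>, which
            already belongs to \<open>A\<close>.\<close>
          moreover have "y \<noteq> u"
          proof
            assume "y = u"
            then have "(u, v) \<in> F" using fuv 4(1) by (simp add: F_def)
            then show False using uv(2) by (simp add: A_def)
          qed
          moreover have "v \<noteq> d" using v t(2) by blast
          ultimately show ?thesis using dy by (intro hitI[of d y])
        next
          case False
          then have eA: "(e, f e) \<in> A" using e(1) by (simp add: A_def C_def)
          \<comment> \<open>The alternative \<open>u = e\<close> would make \<open>(u, v)\<close>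
            equal to \<open>(e, f e)\<close>, an arc of \<open>A\<close>.\<close>
          then have "(u, e) \<in> parcs G" using fuv uv(2) e(2) by metis
          moreover have "f e \<in> S" using f[of e] e(1) D by blast
          then have "f e \<noteq> u" using 4(1) by blast
          moreover have "v \<noteq> e" using v \<open>e \<notin> S\<close> by blast
          ultimately show ?thesis using eA by (intro hitI[of e "f e"])
        qed
      qed
    qed
    then show "\<exists>(x, y)\<in>A. (u, x) \<in> parcs G \<and> v \<noteq> x \<and> y \<noteq> u"
      unfolding hit_def .
  qed
  then have "domination_number (with_proj (three_arc_graph G)) \<le> card A"
    by (rule X.domination_number_le)
  \<comment> \<open>The arcs \<open>(t, d)\<close> and \<open>(d, y)\<close> cost two where
    \<open>t\<close> would have cost three; the other vertices of \<open>S\<close> cost at most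
    three each, so \<open>S\<close> accounts for at most \<open>3 * card S - 1\<close> arcs.\<close>
  moreover have "card A \<le> 2 + card F + card B + card C"
  proof -
    have "card {(t, d), (d, y)} \<le> 2" by (simp add: card_insert_if)
    then show ?thesis
      unfolding A_def
      using card_Un_le[of "{(t, d), (d, y)} \<union> F \<union> B" C]
        card_Un_le[of "{(t, d), (d, y)} \<union> F" B] card_Un_le[of "{(t, d), (d, y)}" F] by linarith
  qed
  moreover have "card F = (if y \<in> S then 0 else 1)"
    by (simp add: F_def)
  moreover have "card B \<le> 3 * card (S - {t})"
  proof -
    have "card B \<le> (\<Sum>s\<in>S - {t}. card {(s, p s), (s, q s), (p s, r s)})"
      unfolding B_def using fin by (intro card_UN_le) auto
    also have "\<dots> \<le> (\<Sum>s\<in>S - {t}. 3)"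
      by (intro sum_mono) (simp add: card_insert_if)
    finally show ?thesis by simp
  qed
  moreover have "card C \<le> card (D - {d})"
    unfolding C_def using fin by (intro card_image_le) auto
  moreover have "card S = Suc (card (S - {t}))"
    using fin t by (metis card.remove)
  ultimately show ?thesis by (simp split: if_splits)
qed

text \<open>For \<open>S\<close> and \<open>D\<close> attaining the two minima, it remains to find a
  path \<open>t\<close>, \<open>d\<close>, \<open>y\<close> for which the possible extra arc leaving
  \<open>y\<close> is paid for.\<close>

theorem three_arc_domination_number_bound:
  assumes nonempty: "pverts G \<noteq> {}" and deg: "min_degree (with_proj G) \<ge> 2"
  shows "domination_number (with_proj (three_arc_graph G)) + 1 \<le>
    3 * domination_number (with_proj G)
    + (MIN S\<in>gamma_sets (with_proj G). rel_domination_number (delete_verts (with_proj G) S)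
         (verts_of_degree_ge (min_degree (with_proj G) - 1) (delete_verts (with_proj G) S)))"
    (is "_ \<le> _ + (MIN S\<in>_. rel_domination_number (?H S) (?U S))")
proof -
  have "(MIN S\<in>gamma_sets (with_proj G). rel_domination_number (?H S) (?U S))
      \<in> (\<lambda>S. rel_domination_number (?H S) (?U S)) ` gamma_sets (with_proj G)"
    using finite_gamma_sets gamma_sets_nonempty by (intro Min_in) auto
  then obtain S where S_gamma: "S \<in> gamma_sets (with_proj G)"
    and S_min: "(MIN S\<in>gamma_sets (with_proj G). rel_domination_number (?H S) (?U S))
      = rel_domination_number (?H S) (?U S)" by auto
  from S_gamma have S: "dominating_set (with_proj G) S"
    and S_card: "card S = domination_number (with_proj G)"
    by (auto simp: gamma_sets_def)
  have "?U S \<subseteq> pverts G - S" by (auto simp: verts_of_degree_ge_def)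
  then obtain D where D: "rel_dominating_set (?H S) (?U S) D"
    and D_card: "card D = rel_domination_number (?H S) (?U S)"
    by (rule rel_domination_number_attained)
  have D_sub: "D \<subseteq> pverts G - S" and D_dom: "?U S \<subseteq> closed_nbhd (?H S) D"
    using D by (auto simp: rel_dominating_set_def)
  have cover: "\<exists>d\<in>D. u = d \<or> (u, d) \<in> parcs G"
    if "u \<in> pverts G - S" "\<And>s. s \<in> S \<Longrightarrow> (u, s) \<in> parcs G \<Longrightarrow> s = v" for u v
  proof -
    have "u \<in> ?U S"
      using that out_degree_delete_verts[of u S v] by (auto simp: verts_of_degree_ge_def)
    then have "u \<in> closed_nbhd (?H S) D"
      using D_dom by blast
    then show ?thesis
      by (auto simp: closed_nbhd_def adj_delete_verts_iff dest: arc_sym)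
  qed
  have neighbour_in_S: "\<exists>t\<in>S. (t, d) \<in> parcs G" if "d \<in> pverts G - S" for d
    using S that by (auto simp: dominating_set_iff)
  \<comment> \<open>A \<open>d\<close> taken from \<open>D\<close> frees one arc, which pays for any
    \<open>y\<close>. If \<open>D\<close> is empty, nothing is freed and \<open>y\<close> has to lie
    in \<open>S\<close>.\<close>
  have "\<exists>d t y. t \<in> S \<and> d \<notin> S \<and> (t, d) \<in> parcs G \<and> (d, y) \<in> parcs G \<and> y \<noteq> t \<and>
      card (D - {d}) + (if y \<in> S then 0 else 1) \<le> card D"
  proof (cases "D = {}")
    case False
    then obtain d where d: "d \<in> D" by blast
    obtain t where t: "t \<in> S" "(t, d) \<in> parcs G"
      using neighbour_in_S d D_sub by blast
    obtain y where y: "(d, y) \<in> parcs G" "y \<noteq> t"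
      using exists_other_neighbour[OF deg, of d t] d D_sub by blast
    have "finite D"
      using D_sub pair_finite_verts by (auto intro: finite_subset)
    then have "card D = Suc (card (D - {d}))"
      using d by (metis card.remove)
    then show ?thesis using d D_sub t y by (intro exI[of _ d] exI[of _ t] exI[of _ y]) auto
  next
    case True
    \<comment> \<open>A minimum dominating set omits some vertex: \<open>w\<close> has a neighbour,
      so the vertices other than \<open>w\<close> already dominate.\<close>
    obtain w where w: "w \<in> pverts G" using nonempty by blast
    obtain x where "(w, x) \<in> parcs G" "x \<noteq> w"
      using exists_other_neighbour[OF deg w, of w] by blast
    then have "x \<in> pverts G - {w}" "(x, w) \<in> parcs G"
      using arc_in_verts arc_sym by blast+
    then have "dominating_set (with_proj G) (pverts G - {w})"
      unfolding dominating_set_iff by blast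
    then have "card S \<le> card (pverts G - {w})"
      using domination_number_le S_card by simp
    also have "\<dots> < card (pverts G)"
      using w pair_finite_verts by (intro psubset_card_mono) auto
    finally have "S \<noteq> pverts G" by blast
    then obtain d where d: "d \<in> pverts G - S"
      using S by (auto simp: dominating_set_iff)
    obtain t where t: "t \<in> S" "(t, d) \<in> parcs G"
      using neighbour_in_S d by blast
    \<comment> \<open>Were \<open>t\<close> the only neighbour of \<open>d\<close> in
      \<open>S\<close>, then \<open>cover\<close> would yield an element of the empty set
      \<open>D\<close>.\<close>
    obtain y where "y \<in> S" "(d, y) \<in> parcs G" "y \<noteq> t"
      using cover[OF d, of t] True by blast
    then show ?thesis using d t True by (intro exI[of _ d] exI[of _ t] exI[of _ y]) auto
  qed
  then obtain d t y where path: "t \<in> S" "d \<notin> S" "(t, d) \<in> parcs G" "(d, y) \<in> parcs G" "y \<noteq> t"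
    and le: "card (D - {d}) + (if y \<in> S then 0 else 1) \<le> card D" by blast
  have "domination_number (with_proj (three_arc_graph G)) + 1 \<le>
      3 * card S + card (D - {d}) + (if y \<in> S then 0 else 1)"
    by (rule three_arc_domination_number_le[OF deg S D_sub _ path]) (rule cover)
  then show ?thesis
    using le unfolding S_min S_card[symmetric] D_card[symmetric] by linarith
qed

end

section \<open>The triangle as an extremal graph\<close>

definition triangle_graph :: "nat pair_pre_digraph" where
  "triangle_graph = \<lparr> pverts = {0, 1, 2}, parcs = {(u, v). u \<in> {0, 1, 2} \<and> v \<in> {0, 1, 2} \<and> u \<noteq> v} \<rparr>"

lemma triangle_simps:
  "pverts triangle_graph = {0, 1, 2}"
  "(u, v) \<in> parcs triangle_graph \<longleftrightarrow> u \<in> {0, 1, 2} \<and> v \<in> {0, 1, 2} \<and> u \<noteq> v"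
  by (auto simp: triangle_graph_def)

lemma pair_graph_triangle: "pair_graph triangle_graph"
proof
  show "finite (parcs triangle_graph)"
    by (rule finite_subset[of _ "{0, 1, 2} \<times> {0, 1, 2}"]) (auto simp: triangle_simps)
  show "symmetric (with_proj triangle_graph)"
    by (auto simp: triangle_simps symmetric_def intro!: symI)
qed (auto simp: triangle_simps)

interpretation triangle: pair_graph triangle_graph
  by (rule pair_graph_triangle)

lemma out_degree_triangle:
  assumes "u \<in> pverts triangle_graph"
  shows "out_degree (with_proj triangle_graph) u = 2"
proof -
  have "out_arcs (with_proj triangle_graph) u = Pair u ` ({0, 1, 2} - {u})"
    using assms by (auto simp: triangle_simps out_arcs_def)
  then show ?thesis
    using assms by (auto simp: out_degree_def card_image inj_on_def triangle_simps)
qed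

lemma min_degree_triangle: "min_degree (with_proj triangle_graph) = 2"
proof -
  have "out_degree (with_proj triangle_graph) ` pverts triangle_graph = {2}"
    using out_degree_triangle by (force simp: triangle_simps)
  then show ?thesis by (simp add: min_degree_def)
qed

lemma domination_number_triangle: "domination_number (with_proj triangle_graph) = 1"
proof -
  have "dominating_set (with_proj triangle_graph) {0}"
    by (auto simp: triangle.dominating_set_iff triangle_simps)
  then have "domination_number (with_proj triangle_graph) \<le> 1"
    using triangle.domination_number_le by fastforce
  moreover have "domination_number (with_proj triangle_graph) \<noteq> 0"
  proof -
    obtain S where S: "dominating_set (with_proj triangle_graph) S"
      "card S = domination_number (with_proj triangle_graph)"
      by (rule triangle.domination_number_attained)
    then have "S \<noteq> {}" "finite S"
      by (auto simp: triangle.dominating_set_iff triangle_simps dest: finite_subset)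
    then show ?thesis using S by auto
  qed
  ultimately show ?thesis by simp
qed

text \<open>The two vertices left after deleting \<open>0\<close> are adjacent, so \<open>1\<close>
  dominates both, whatever the degree threshold.\<close>

lemma rel_domination_number_triangle_le:
  "rel_domination_number (delete_verts (with_proj triangle_graph) {0})
     (verts_of_degree_ge i (delete_verts (with_proj triangle_graph) {0})) \<le> 1"
proof -
  have "rel_dominating_set (delete_verts (with_proj triangle_graph) {0})
     (verts_of_degree_ge i (delete_verts (with_proj triangle_graph) {0})) {1}"
    by (auto simp: rel_dominating_set_def closed_nbhd_def triangle.adj_delete_verts_iff
        verts_of_degree_ge_def) (auto simp: triangle_simps)
  then have "rel_domination_number (delete_verts (with_proj triangle_graph) {0})
     (verts_of_degree_ge i (delete_verts (with_proj triangle_graph) {0})) \<le> card {1::nat}"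
    unfolding rel_domination_number_def
    using triangle.finite_rel_dominating_sets by (intro Min_le) blast+
  then show ?thesis by simp
qed

text \<open>In the 3-arc graph of the triangle, adjacent arcs have the same head.\<close>

lemma domination_number_three_arc_triangle_ge:
  "3 \<le> domination_number (with_proj (three_arc_graph triangle_graph))"
proof -
  interpret X: pair_graph "three_arc_graph triangle_graph"
    by (rule triangle.pair_graph_three_arc_graph)
  obtain A where A: "dominating_set (with_proj (three_arc_graph triangle_graph)) A"
    "card A = domination_number (with_proj (three_arc_graph triangle_graph))"
    by (rule X.domination_number_attained)
  \<comment> \<open>Domination preserves heads here, so all three vertices must occur as heads of
    arcs in \<open>A\<close>.\<close>
  have "v \<in> snd ` A" if v: "v \<in> {0, 1, 2}" for v
  proof -
    have "(if v = 0 then 1 else 0, v) \<in> parcs triangle_graph"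
      using v by (simp add: triangle_simps)
    then obtain u where uv: "(u, v) \<in> parcs triangle_graph" by blast
    show ?thesis
    proof (cases "(u, v) \<in> A")
      case True
      then show ?thesis by force
    next
      case False
      then have "(u, v) \<in> pverts (three_arc_graph triangle_graph) - A"
        using uv by (simp add: three_arc_graph_def)
      then obtain a where "a \<in> A" "(a, (u, v)) \<in> parcs (three_arc_graph triangle_graph)"
        using A(1) unfolding X.dominating_set_iff by blast
      then obtain x y where xy: "(x, y) \<in> A"
        "((x, y), (u, v)) \<in> parcs (three_arc_graph triangle_graph)"
        by (cases a) simp
      then have "(x, y) \<in> parcs triangle_graph" "(x, u) \<in> parcs triangle_graph" "y \<noteq> u" "v \<noteq> x"
        by (auto simp: three_arc_graph_def triangle.three_arc_iff)
      \<comment> \<open>Both \<open>y\<close> and \<open>v\<close> are the third vertex, distinct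
        from the adjacent vertices \<open>x\<close> and \<open>u\<close>.\<close>
      then have "y = v" using uv by (auto simp: triangle_simps)
      then show ?thesis using xy(1) by force
    qed
  qed
  then have "{0, 1, 2} \<subseteq> snd ` A" by blast
  moreover have "finite A"
    using A(1) X.pair_finite_verts by (auto simp: X.dominating_set_iff intro: finite_subset)
  ultimately have "card {0, 1, 2 :: nat} \<le> card A"
    by (meson card_image_le card_mono finite_imageI le_trans)
  then show ?thesis using A(2) by simp
qed

text \<open>The cast to \<open>int\<close> makes the final \<open>- 1\<close> a true subtraction;
  the bound over the naturals carries \<open>+ 1\<close> on the left instead.\<close>

theorem theorem5:
  shows
   "(\<forall>G :: 'a pair_pre_digraph. pair_graph G \<and> pverts G \<noteq> {} \<and> min_degree G \<ge> 2 \<longrightarrow>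
       int (domination_number (three_arc_graph G)) \<le>
         3 * int (domination_number G)
         + int (MIN S\<in>gamma_sets G. rel_domination_number (delete_verts G S)
                  (verts_of_degree_ge (min_degree G - 1) (delete_verts G S)))
         - 1) \<and>
    (\<exists>H :: nat pair_pre_digraph. pair_graph H \<and> pverts H \<noteq> {} \<and> min_degree H \<ge> 2 \<and>
       int (domination_number (three_arc_graph H)) =
         3 * int (domination_number H)
         + int (MIN S\<in>gamma_sets H. rel_domination_number (delete_verts H S)
                  (verts_of_degree_ge (min_degree H - 1) (delete_verts H S)))
         - 1)"
proof (rule conjI)
  show "\<forall>G :: 'a pair_pre_digraph. pair_graph G \<and> pverts G \<noteq> {} \<and> min_degree G \<ge> 2 \<longrightarrow>
       int (domination_number (three_arc_graph G)) \<le>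
         3 * int (domination_number G)
         + int (MIN S\<in>gamma_sets G. rel_domination_number (delete_verts G S)
                  (verts_of_degree_ge (min_degree G - 1) (delete_verts G S)))
         - 1" (is "\<forall>G. _ \<longrightarrow> ?bound G")
  proof (intro allI impI)
    fix G :: "'a pair_pre_digraph"
    assume "pair_graph G \<and> pverts G \<noteq> {} \<and> min_degree G \<ge> 2"
    then show "?bound G"
      using pair_graph.three_arc_domination_number_bound[of G] by linarith
  qed
next
  let ?rel = "\<lambda>S. rel_domination_number (delete_verts (with_proj triangle_graph) S)
    (verts_of_degree_ge (min_degree (with_proj triangle_graph) - 1)
      (delete_verts (with_proj triangle_graph) S))"
  let ?m = "MIN S\<in>gamma_sets (with_proj triangle_graph). ?rel S"
  have nonempty: "pverts triangle_graph \<noteq> {}"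
    by (simp add: triangle_simps)
  have deg: "min_degree (with_proj triangle_graph) \<ge> 2"
    by (simp only: min_degree_triangle)
  have "dominating_set (with_proj triangle_graph) {0}"
    by (auto simp: triangle.dominating_set_iff triangle_simps)
  then have "{0} \<in> gamma_sets (with_proj triangle_graph)"
    by (simp add: gamma_sets_def domination_number_triangle)
  then have "?m \<le> ?rel {0}"
    by (intro Min_le finite_imageI triangle.finite_gamma_sets imageI)
  also have "\<dots> \<le> 1"
    by (rule rel_domination_number_triangle_le)
  \<comment> \<open>The general bound gives at most \<open>2 + ?m\<close>, hence at most 3, and the
    lower bound 3 forces equality and \<open>?m = 1\<close>.\<close>
  finally have "int (domination_number (with_proj (three_arc_graph triangle_graph))) =
      3 * int (domination_number (with_proj triangle_graph)) + int ?m - 1"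
    using triangle.three_arc_domination_number_bound[OF nonempty deg]
      domination_number_triangle domination_number_three_arc_triangle_ge by linarith
  then show "\<exists>H :: nat pair_pre_digraph. pair_graph H \<and> pverts H \<noteq> {} \<and> min_degree H \<ge> 2 \<and>
       int (domination_number (three_arc_graph H)) =
         3 * int (domination_number H)
         + int (MIN S\<in>gamma_sets H. rel_domination_number (delete_verts H S)
                  (verts_of_degree_ge (min_degree H - 1) (delete_verts H S)))
         - 1"
    using pair_graph_triangle nonempty deg by blast
qed

end
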